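(* Let $\Gamma$ be a lattice in $\mathbb{R}^d\times\mathbb{R}$ in general position, let $I\subset\mathbb{R}$ be a semi-closed interval, $I=[a,b)$ or $I=(a,b]$, and let $\Lambda=\Lambda(\Gamma,I)=\{p_1(\gamma):\gamma\in\Gamma,\ p_2(\gamma)\in I\}\subset\mathbb{R}^d$ be the corresponding simple quasicrystal. Suppose that $|I|\notin p_2(\Gamma)$. Then there exists no Riemann measurable set $S\subset\mathbb{R}^d$ such that the exponential system $E(\Lambda)$ is a Riesz basis in $L^2(S)$.
   Context: A lattice in $\mathbb{R}^k$ is the image of $\mathbb{Z}^k$ under an invertible $k\times k$ matrix. $p_1$ and $p_2$ denote the projections of $\mathbb{R}^d\times\mathbb{R}$ onto $\mathbb{R}^d$ and $\mathbb{R}$ respectively. The lattice $\Gamma$ is in general position if the restrictions of $p_1$ and $p_2$ to $\Gamma$ are injective and $p_1(\Gamma)$, $p_2(\Gamma)$ are dense in $\mathbb{R}^d$ and $\mathbb{R}$ respectively. Here $a<b$ are real and $|I|=b-a$ is the length of $I$. A bounded set $S\subset\mathbb{R}^d$ is Riemann measurable if its boundary has Lebesgue measure zero. $E(\Lambda)=\{e^{2\pi i\langle\lambda,x\rangle}\}_{\lambda\in\Lambda}$. A system $\{f_n\}$ in a Hilbert space $H$ is a Riesz basis if every $f\in H$ admits a unique expansion $f=\sum c_nf_n$, and the coefficients satisfy $A\|f\|^2\le\sum|c_n|^2\le B\|f\|^2$ with positive constants $A,B$ not depending on $f$ (equivalently, $\{f_n\}$ is both a frame and a Riesz sequence in $H$).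 *)

theory Defs
  imports "HOL-Analysis.Analysis"
begin

text \<open>
  Lattices are defined in an arbitrary Euclidean space so that the definition applies directly to
  \<open>(real ^ 'd) \<times> real\<close>: the points with integer coordinates in the standard basis play the role
  of \<open>\<int>\<^sup>k\<close>, and a linear bijection is multiplication by an invertible \<open>k \<times> k\<close> matrix in that basis.
\<close>

definition integer_points :: "'a::euclidean_space set"
  where "integer_points = {x. \<forall>b\<in>Basis. x \<bullet> b \<in> \<int>}"

definition is_lattice :: "'a::euclidean_space set \<Rightarrow> bool"
  where "is_lattice \<Gamma> \<longleftrightarrow> (\<exists>T :: 'a \<Rightarrow> 'a. linear T \<and> bij T \<and> \<Gamma> = T ` integer_points)"

definition general_position :: "('a::euclidean_space \<times> real) set \<Rightarrow> bool"
  where "general_position \<Gamma> \<longleftrightarrow>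
    inj_on fst \<Gamma> \<and> inj_on snd \<Gamma> \<and> closure (fst ` \<Gamma>) = UNIV \<and> closure (snd ` \<Gamma>) = UNIV"

definition quasicrystal :: "('a \<times> real) set \<Rightarrow> real set \<Rightarrow> 'a set"
  where "quasicrystal \<Gamma> I = {fst \<gamma> |\<gamma>. \<gamma> \<in> \<Gamma> \<and> snd \<gamma> \<in> I}"

definition riemann_measurable :: "'a::euclidean_space set \<Rightarrow> bool"
  where "riemann_measurable S \<longleftrightarrow> bounded S \<and> frontier S \<in> null_sets lebesgue"

definition exponential :: "'a::euclidean_space \<Rightarrow> 'a \<Rightarrow> complex"
  where "exponential \<xi> = (\<lambda>x. exp (2 * of_real pi * \<i> * of_real (\<xi> \<bullet> x)))"

text \<open>
  Elements of the Hilbert space \<open>L\<^sup>2(M)\<close> are represented by square-integrable functions. Functions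
  agreeing almost everywhere are not identified, but everything below depends on them only through
  the seminorm \<open>L2_norm M\<close>, which does not see null sets.
\<close>

definition L2_fun :: "'a measure \<Rightarrow> ('a \<Rightarrow> complex) set"
  where "L2_fun M = {f \<in> borel_measurable M. integrable M (\<lambda>x. (cmod (f x))\<^sup>2)}"

definition L2_norm :: "'a measure \<Rightarrow> ('a \<Rightarrow> complex) \<Rightarrow> real"
  where "L2_norm M f = sqrt (\<integral>x. (cmod (f x))\<^sup>2 \<partial>M)"

text \<open>
  The index set \<open>N\<close> carries no preferred enumeration, so \<open>f = (\<Sum>n\<in>N. c n * e n)\<close> is read as
  unordered summation: convergence in \<open>L\<^sup>2(M)\<close> of the net of finite partial sums. Together with the
  two-sided coefficient bound required of a Riesz basis, this is equivalent to norm convergence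
  along any fixed enumeration of a countably infinite \<open>N\<close>.
\<close>

definition L2_expansion ::
    "'a measure \<Rightarrow> 'i set \<Rightarrow> ('i \<Rightarrow> 'a \<Rightarrow> complex) \<Rightarrow> ('i \<Rightarrow> complex) \<Rightarrow> ('a \<Rightarrow> complex) \<Rightarrow> bool"
  where "L2_expansion M N e c f \<longleftrightarrow>
    ((\<lambda>F. L2_norm M (\<lambda>x. f x - (\<Sum>n\<in>F. c n * e n x))) \<longlongrightarrow> 0) (finite_subsets_at_top N)"

text \<open>
  Coefficient families are total functions on the index type; only their values on \<open>N\<close> are
  meaningful, so uniqueness is required on \<open>N\<close> only.
\<close>

definition riesz_basis_L2 :: "'a measure \<Rightarrow> 'i set \<Rightarrow> ('i \<Rightarrow> 'a \<Rightarrow> complex) \<Rightarrow> bool"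
  where "riesz_basis_L2 M N e \<longleftrightarrow>
    (\<forall>n\<in>N. e n \<in> L2_fun M) \<and>
    (\<exists>A>0. \<exists>B>0. \<forall>f\<in>L2_fun M. \<exists>c.
       L2_expansion M N e c f \<and>
       (\<forall>c'. L2_expansion M N e c' f \<longrightarrow> (\<forall>n\<in>N. c' n = c n)) \<and>
       (\<lambda>n. (cmod (c n))\<^sup>2) summable_on N \<and>
       A * (L2_norm M f)\<^sup>2 \<le> (\<Sum>\<^sub>\<infinity>n\<in>N. (cmod (c n))\<^sup>2) \<and>
       (\<Sum>\<^sub>\<infinity>n\<in>N. (cmod (c n))\<^sup>2) \<le> B * (L2_norm M f)\<^sup>2)"

end

theory Submission
  imports Defs
begin

text \<open>
  Multiplying by \<open>exponential (fst \<gamma>)\<close> shows that all quasicrystals with window \<open>I + snd \<gamma>\<close>,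
  \<open>\<gamma> \<in> \<Gamma>\<close>, give Riesz bases with the same constants. Take \<open>I = [a, b)\<close> and \<open>L = b - a\<close>. Shifts of
  \<open>I\<close> to windows \<open>[-\<eta>, L - \<eta>)\<close> with small \<open>\<eta> > 0\<close> show that the frequencies over \<open>[0, L)\<close> have
  a lower Riesz bound. Shifts to windows \<open>[\<eta>, L + \<eta>)\<close> expand the constant function \<open>1\<close> into
  frequencies over \<open>(0, L)\<close> and an error with frequencies over \<open>[L, L + \<eta>)\<close>. As \<open>L \<notin> snd ` \<Gamma>\<close>,
  letting \<open>\<eta>\<close> decrease produces errors with pairwise disjoint spectra, so the sum of \<open>m\<close> of them
  has squared norm \<open>O(m)\<close>. But \<open>m\<close> times the constant function has squared distance at least of
  order \<open>m\<^sup>2\<close> from the span of the frequencies over \<open>(0, L)\<close>, because \<open>0\<close> and these frequencies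
  all lie over \<open>[0, L)\<close>.
\<close>

section \<open>Square-integrable functions and their seminorm\<close>

lemma L2_norm_power2: "(L2_norm M f)\<^sup>2 = (\<integral>x. (cmod (f x))\<^sup>2 \<partial>M)"
  unfolding L2_norm_def by simp

lemma cmod_add_power2_le: "(cmod (u + v))\<^sup>2 \<le> 2 * (cmod u)\<^sup>2 + 2 * (cmod v)\<^sup>2"
proof -
  have "(cmod (u + v))\<^sup>2 \<le> (cmod u + cmod v)\<^sup>2"
    by (simp add: norm_triangle_ineq power_mono)
  also have "\<dots> \<le> 2 * (cmod u)\<^sup>2 + 2 * (cmod v)\<^sup>2"
    using sum_squares_bound[of "cmod u" "cmod v"] by (simp add: power2_sum)
  finally show ?thesis .
qed

lemma L2_fun_add:
  assumes "f \<in> L2_fun M" "g \<in> L2_fun M"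
  shows "(\<lambda>x. f x + g x) \<in> L2_fun M"
proof -
  have [measurable]: "f \<in> borel_measurable M" "g \<in> borel_measurable M"
    using assms by (auto simp: L2_fun_def)
  have "integrable M (\<lambda>x. (cmod (f x + g x))\<^sup>2)"
  proof (rule Bochner_Integration.integrable_bound)
    show "integrable M (\<lambda>x. 2 * (cmod (f x))\<^sup>2 + 2 * (cmod (g x))\<^sup>2)"
      using assms by (auto simp: L2_fun_def)
  qed (auto intro!: AE_I2 simp: cmod_add_power2_le)
  then show ?thesis by (simp add: L2_fun_def)
qed

lemma L2_norm_add_power2_le:
  assumes "f \<in> L2_fun M" "g \<in> L2_fun M"
  shows "(L2_norm M (\<lambda>x. f x + g x))\<^sup>2 \<le> 2 * (L2_norm M f)\<^sup>2 + 2 * (L2_norm M g)\<^sup>2"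
proof -
  have int: "integrable M (\<lambda>x. (cmod (f x))\<^sup>2)" "integrable M (\<lambda>x. (cmod (g x))\<^sup>2)"
    "integrable M (\<lambda>x. (cmod (f x + g x))\<^sup>2)"
    using assms L2_fun_add[OF assms] by (auto simp: L2_fun_def)
  have "(\<integral>x. (cmod (f x + g x))\<^sup>2 \<partial>M) \<le> (\<integral>x. 2 * (cmod (f x))\<^sup>2 + 2 * (cmod (g x))\<^sup>2 \<partial>M)"
    using int by (intro integral_mono) (auto simp: cmod_add_power2_le)
  also have "\<dots> = 2 * (\<integral>x. (cmod (f x))\<^sup>2 \<partial>M) + 2 * (\<integral>x. (cmod (g x))\<^sup>2 \<partial>M)"
    using int by simp
  finally show ?thesis by (simp add: L2_norm_power2)
qed

lemma L2_fun_mult: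
  assumes "f \<in> L2_fun M"
  shows "(\<lambda>x. k * f x) \<in> L2_fun M"
  using assms by (auto simp: L2_fun_def norm_mult power_mult_distrib)

lemma L2_fun_sum:
  assumes "\<And>n. n \<in> F \<Longrightarrow> f n \<in> L2_fun M"
  shows "(\<lambda>x. \<Sum>n\<in>F. f n x) \<in> L2_fun M"
  using assms
proof (induction F rule: infinite_finite_induct)
  case (insert n F)
  then show ?case using L2_fun_add[of "f n" M "\<lambda>x. \<Sum>n\<in>F. f n x"] by simp
qed (simp_all add: L2_fun_def)

section \<open>Riesz bounds expressed through finite linear combinations\<close>

definition lin_comb :: "('i \<Rightarrow> 'a \<Rightarrow> complex) \<Rightarrow> 'i set \<Rightarrow> ('i \<Rightarrow> complex) \<Rightarrow> 'a \<Rightarrow> complex"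
  where "lin_comb e F c = (\<lambda>x. \<Sum>n\<in>F. c n * e n x)"

text \<open>A finitary form of the Riesz basis property: a Riesz sequence inequality with lower
  bound \<open>1/B\<close> and upper bound \<open>1/A\<close>, and approximation with coefficients
  controlled independently of the accuracy \<epsilon>. The constants are explicit so that all
  shifted windows can share them.\<close>

definition riesz_bounds ::
    "'a measure \<Rightarrow> ('i \<Rightarrow> 'a \<Rightarrow> complex) \<Rightarrow> real \<Rightarrow> real \<Rightarrow> 'i set \<Rightarrow> bool"
  where "riesz_bounds M e A B N \<longleftrightarrow>
    (\<forall>F c. finite F \<longrightarrow> F \<subseteq> N \<longrightarrow>
       A * (L2_norm M (lin_comb e F c))\<^sup>2 \<le> (\<Sum>n\<in>F. (cmod (c n))\<^sup>2) \<and>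
       (\<Sum>n\<in>F. (cmod (c n))\<^sup>2) \<le> B * (L2_norm M (lin_comb e F c))\<^sup>2) \<and>
    (\<forall>f\<in>L2_fun M. \<forall>\<epsilon>>0. \<exists>F c. finite F \<and> F \<subseteq> N \<and>
       (L2_norm M (\<lambda>x. f x - lin_comb e F c x))\<^sup>2 \<le> \<epsilon> \<and>
       (\<Sum>n\<in>F. (cmod (c n))\<^sup>2) \<le> B * (L2_norm M f)\<^sup>2)"

lemma L2_fun_lin_comb:
  assumes "\<And>n. n \<in> F \<Longrightarrow> e n \<in> L2_fun M"
  shows "lin_comb e F c \<in> L2_fun M"
  unfolding lin_comb_def by (intro L2_fun_sum L2_fun_mult assms)

lemma lin_comb_extend:
  assumes "finite G" "F \<subseteq> G"
  shows "lin_comb e F c = lin_comb e G (\<lambda>n. if n \<in> F then c n else 0)"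
  unfolding lin_comb_def
  by (intro ext sum.mono_neutral_cong_left) (use assms in auto)

lemma lin_comb_add: "lin_comb e F c x + lin_comb e F c' x = lin_comb e F (\<lambda>n. c n + c' n) x"
  by (simp add: lin_comb_def sum.distrib algebra_simps)

text \<open>The partial sums are eventually constant: the error vanishes for every finite set
  containing \<open>F\<close>.\<close>

lemma L2_expansion_lin_comb:
  assumes "finite F" "F \<subseteq> N"
  shows "L2_expansion M N e (\<lambda>n. if n \<in> F then c n else 0) (lin_comb e F c)"
proof -
  have "\<forall>\<^sub>F G in finite_subsets_at_top N. L2_norm M (\<lambda>x. lin_comb e F c x -
      (\<Sum>n\<in>G. (if n \<in> F then c n else 0) * e n x)) = 0"
    unfolding eventually_finite_subsets_at_top
  proof (intro exI[of _ F] conjI assms allI impI)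
    fix G assume "finite G \<and> F \<subseteq> G \<and> G \<subseteq> N"
    then have "lin_comb e F c x = (\<Sum>n\<in>G. (if n \<in> F then c n else 0) * e n x)" for x
      using lin_comb_extend[of G F e c] by (simp add: lin_comb_def)
    then show "L2_norm M (\<lambda>x. lin_comb e F c x -
        (\<Sum>n\<in>G. (if n \<in> F then c n else 0) * e n x)) = 0"
      by (simp add: L2_norm_def)
  qed
  then show ?thesis
    unfolding L2_expansion_def by (rule tendsto_eventually)
qed

text \<open>By uniqueness, a finite combination has its own zero-padded coefficients as expansion,
  so the infinite sums reduce to finite ones. The approximation clause comes from truncating an
  expansion, which does not increase the coefficient sum.\<close>

lemma riesz_basis_L2_bounds:
  assumes "riesz_basis_L2 M N e"
  obtains A B where "A > 0" "B > 0" "riesz_bounds M e A B N"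
proof -
  obtain A B where AB: "A > 0" "B > 0" and basis: "\<And>f. f \<in> L2_fun M \<Longrightarrow> \<exists>c.
       L2_expansion M N e c f \<and>
       (\<forall>c'. L2_expansion M N e c' f \<longrightarrow> (\<forall>n\<in>N. c' n = c n)) \<and>
       (\<lambda>n. (cmod (c n))\<^sup>2) summable_on N \<and>
       A * (L2_norm M f)\<^sup>2 \<le> (\<Sum>\<^sub>\<infinity>n\<in>N. (cmod (c n))\<^sup>2) \<and>
       (\<Sum>\<^sub>\<infinity>n\<in>N. (cmod (c n))\<^sup>2) \<le> B * (L2_norm M f)\<^sup>2"
    and e: "\<And>n. n \<in> N \<Longrightarrow> e n \<in> L2_fun M"
    using assms unfolding riesz_basis_L2_def by blast
  have "A * (L2_norm M (lin_comb e F c))\<^sup>2 \<le> (\<Sum>n\<in>F. (cmod (c n))\<^sup>2) \<and>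
      (\<Sum>n\<in>F. (cmod (c n))\<^sup>2) \<le> B * (L2_norm M (lin_comb e F c))\<^sup>2"
    if F: "finite F" "F \<subseteq> N" for F c
  proof -
    have "lin_comb e F c \<in> L2_fun M"
      using F e by (intro L2_fun_lin_comb) auto
    then obtain c' where c': "\<And>c''. L2_expansion M N e c'' (lin_comb e F c) \<Longrightarrow> \<forall>n\<in>N. c'' n = c' n"
      "A * (L2_norm M (lin_comb e F c))\<^sup>2 \<le> (\<Sum>\<^sub>\<infinity>n\<in>N. (cmod (c' n))\<^sup>2)"
      "(\<Sum>\<^sub>\<infinity>n\<in>N. (cmod (c' n))\<^sup>2) \<le> B * (L2_norm M (lin_comb e F c))\<^sup>2"
      using basis by blast
    have "(\<Sum>\<^sub>\<infinity>n\<in>N. (cmod (c' n))\<^sup>2) = (\<Sum>\<^sub>\<infinity>n\<in>F. (cmod (c n))\<^sup>2)"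
      using c'(1)[OF L2_expansion_lin_comb[OF F]] F(2)
      by (intro infsum_cong_neutral) (auto split: if_splits simp: subset_iff)
    also have "\<dots> = (\<Sum>n\<in>F. (cmod (c n))\<^sup>2)"
      using F by simp
    finally show ?thesis using c' by simp
  qed
  moreover have "\<exists>F c. finite F \<and> F \<subseteq> N \<and>
       (L2_norm M (\<lambda>x. f x - lin_comb e F c x))\<^sup>2 \<le> \<epsilon> \<and>
       (\<Sum>n\<in>F. (cmod (c n))\<^sup>2) \<le> B * (L2_norm M f)\<^sup>2"
    if f: "f \<in> L2_fun M" and "\<epsilon> > 0" for f \<epsilon>
  proof -
    obtain c where c: "L2_expansion M N e c f" "(\<lambda>n. (cmod (c n))\<^sup>2) summable_on N"
      "(\<Sum>\<^sub>\<infinity>n\<in>N. (cmod (c n))\<^sup>2) \<le> B * (L2_norm M f)\<^sup>2"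
      using basis[OF f] by blast
    have "((\<lambda>F. (L2_norm M (\<lambda>x. f x - lin_comb e F c x))\<^sup>2) \<longlongrightarrow> 0\<^sup>2) (finite_subsets_at_top N)"
      using c(1) unfolding L2_expansion_def lin_comb_def by (rule tendsto_power)
    then have "\<forall>\<^sub>F F in finite_subsets_at_top N. (L2_norm M (\<lambda>x. f x - lin_comb e F c x))\<^sup>2 < \<epsilon>"
      using \<open>\<epsilon> > 0\<close> by (intro order_tendstoD(2)) auto
    then obtain F where F: "finite F" "F \<subseteq> N" "(L2_norm M (\<lambda>x. f x - lin_comb e F c x))\<^sup>2 < \<epsilon>"
      unfolding eventually_finite_subsets_at_top by blast
    have "(\<Sum>n\<in>F. (cmod (c n))\<^sup>2) \<le> (\<Sum>\<^sub>\<infinity>n\<in>N. (cmod (c n))\<^sup>2)"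
      using F c(2) by (intro finite_sum_le_infsum) auto
    then show ?thesis using F c(3) by (intro exI[of _ F] exI[of _ c]) auto
  qed
  ultimately have "riesz_bounds M e A B N"
    unfolding riesz_bounds_def by blast
  then show ?thesis using that AB by blast
qed

section \<open>The exchange contradiction in an abstract system\<close>

text \<open>
  Here \<open>P\<close>, \<open>D\<close> and \<open>z\<close> stand for the frequencies over the open window, those just beyond its
  far end, and the frequency at its near end. The accuracy \<open>\<epsilon>\<close> is quantified inside the induction
  below, so the crude bound \<open>L2_norm_add_power2_le\<close> can replace Minkowski's inequality.
\<close>

lemma riesz_bounds_no_exchange:
  assumes AB: "A > 0" "B > 0"
    and e: "\<And>n. e n \<in> L2_fun M"
    and z: "z \<notin> P"
    and lower: "\<And>F. finite F \<Longrightarrow> F \<subseteq> insert z P \<Longrightarrow> \<exists>X. riesz_bounds M e A B X \<and> F \<subseteq> X"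
    and upper: "riesz_bounds M e A B Y" "D \<subseteq> Y"
    and approx: "\<And>Z. finite Z \<Longrightarrow> Z \<subseteq> D \<Longrightarrow> \<exists>X. riesz_bounds M e A B X \<and> X \<subseteq> P \<union> (D - Z)"
  shows False
proof -
  \<comment> \<open>Bounds the coefficient energy of every approximation of \<open>e z\<close>,
    whichever family is used and however small the error.\<close>
  define K where "K = B * (L2_norm M (e z))\<^sup>2"
  have L2: "lin_comb e F c \<in> L2_fun M" for F c
    by (rule L2_fun_lin_comb) (rule e)
  \<comment> \<open>Each round adds one copy of \<open>e z\<close>. The supports in \<open>D\<close>
    stay disjoint, so their energy grows only linearly in \<open>m\<close>.\<close>
  have main: "\<exists>G g H h. finite G \<and> G \<subseteq> P \<and> finite H \<and> H \<subseteq> D \<and>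
      (L2_norm M (\<lambda>x. of_nat m * e z x - lin_comb e G g x - lin_comb e H h x))\<^sup>2 \<le> \<epsilon> \<and>
      (\<Sum>n\<in>H. (cmod (h n))\<^sup>2) \<le> real m * K" if "\<epsilon> > 0" for m \<epsilon>
    using that
  proof (induction m arbitrary: \<epsilon>)
    case 0
    then show ?case
      by (intro exI[of _ "{}"] exI[of _ "\<lambda>_. 0"]) (simp add: lin_comb_def L2_norm_def)
  next
    case (Suc m)
    \<comment> \<open>Two errors of squared size \<open>\<epsilon> / 4\<close>, each doubled by the
      crude sum bound, add up to \<epsilon>.\<close>
    then have "\<epsilon> / 4 > 0" by simp
    from Suc.IH[OF this] obtain G g H h where *: "finite G" "G \<subseteq> P" "finite H" "H \<subseteq> D"
      "(L2_norm M (\<lambda>x. of_nat m * e z x - lin_comb e G g x - lin_comb e H h x))\<^sup>2 \<le> \<epsilon> / 4"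
      "(\<Sum>n\<in>H. (cmod (h n))\<^sup>2) \<le> real m * K"
      by blast
    \<comment> \<open>Excluding the \<open>D\<close>-frequencies \<open>H\<close> already used makes
      the energies of old and new parts add without cross terms.\<close>
    obtain X where X: "riesz_bounds M e A B X" "X \<subseteq> P \<union> (D - H)"
      using approx[OF *(3,4)] by blast
    obtain F c where F: "finite F" "F \<subseteq> X"
      "(L2_norm M (\<lambda>x. e z x - lin_comb e F c x))\<^sup>2 \<le> \<epsilon> / 4"
      "(\<Sum>n\<in>F. (cmod (c n))\<^sup>2) \<le> K"
      using X(1) e[of z] \<open>\<epsilon> / 4 > 0\<close> unfolding riesz_bounds_def K_def by meson
    define F1 F2 where "F1 = F \<inter> P" and "F2 = F - P"
    have F12: "finite F1" "F1 \<subseteq> P" "finite F2" "F2 \<subseteq> D" "H \<inter> F2 = {}"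
      "F = F1 \<union> F2" "F1 \<inter> F2 = {}"
      using F X by (auto simp: F1_def F2_def)
    \<comment> \<open>The supports \<open>G\<close> and \<open>F1\<close> may overlap, so
      coefficients are added; no bound on \<open>g'\<close> is kept.\<close>
    define g' where "g' n = (if n \<in> G then g n else 0) + (if n \<in> F1 then c n else 0)" for n
    define h' where "h' n = (if n \<in> H then h n else 0) + (if n \<in> F2 then c n else 0)" for n
    have g': "lin_comb e (G \<union> F1) g' x = lin_comb e G g x + lin_comb e F1 c x" for x
      unfolding g'_def lin_comb_add[symmetric]
      using lin_comb_extend[of "G \<union> F1" G e g] lin_comb_extend[of "G \<union> F1" F1 e c] * F12 by simp
    have h': "lin_comb e (H \<union> F2) h' x = lin_comb e H h x + lin_comb e F2 c x" for x
      unfolding h'_def lin_comb_add[symmetric]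
      using lin_comb_extend[of "H \<union> F2" H e h] lin_comb_extend[of "H \<union> F2" F2 e c] * F12 by simp
    have c: "lin_comb e F c x = lin_comb e F1 c x + lin_comb e F2 c x" for x
      unfolding lin_comb_def F12(6) using F12 by (intro sum.union_disjoint) auto
    let ?u = "\<lambda>x. of_nat m * e z x - lin_comb e G g x - lin_comb e H h x"
    let ?v = "\<lambda>x. e z x - lin_comb e F c x"
    have minus: "(\<lambda>x. f x - k x) \<in> L2_fun M" if "f \<in> L2_fun M" "k \<in> L2_fun M" for f k
      using L2_fun_add[OF that(1) L2_fun_mult[OF that(2), of "-1"]] by simp
    have "(L2_norm M (\<lambda>x. ?u x + ?v x))\<^sup>2 \<le> 2 * (L2_norm M ?u)\<^sup>2 + 2 * (L2_norm M ?v)\<^sup>2"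
      by (intro L2_norm_add_power2_le minus L2_fun_mult e L2)
    also have "\<dots> \<le> \<epsilon>" using *(5) F(3) by simp
    also have "(\<lambda>x. ?u x + ?v x) = (\<lambda>x. of_nat (Suc m) * e z x -
        lin_comb e (G \<union> F1) g' x - lin_comb e (H \<union> F2) h' x)"
      by (simp add: g' h' c algebra_simps)
    finally have err: "(L2_norm M (\<lambda>x. of_nat (Suc m) * e z x -
        lin_comb e (G \<union> F1) g' x - lin_comb e (H \<union> F2) h' x))\<^sup>2 \<le> \<epsilon>" .
    have "(\<Sum>n\<in>H \<union> F2. (cmod (h' n))\<^sup>2) = (\<Sum>n\<in>H. (cmod (h' n))\<^sup>2) + (\<Sum>n\<in>F2. (cmod (h' n))\<^sup>2)"
      using * F12 by (intro sum.union_disjoint) auto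
    also have "(\<Sum>n\<in>H. (cmod (h' n))\<^sup>2) = (\<Sum>n\<in>H. (cmod (h n))\<^sup>2)"
      using F12(5) by (intro sum.cong) (auto simp: h'_def)
    also have "(\<Sum>n\<in>F2. (cmod (h' n))\<^sup>2) = (\<Sum>n\<in>F2. (cmod (c n))\<^sup>2)"
      using F12(5) by (intro sum.cong) (auto simp: h'_def)
    also have "(\<Sum>n\<in>F2. (cmod (c n))\<^sup>2) \<le> (\<Sum>n\<in>F. (cmod (c n))\<^sup>2)"
      using F by (intro sum_mono2) (auto simp: F2_def)
    finally have "(\<Sum>n\<in>H \<union> F2. (cmod (h' n))\<^sup>2) \<le> real (Suc m) * K"
      using *(6) F(4) by (simp add: algebra_simps)
    with err * F12 show ?case
      by (intro exI[of _ "G \<union> F1"] exI[of _ g'] exI[of _ "H \<union> F2"] exI[of _ h']) auto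
  qed
  \<comment> \<open>Since \<open>z\<close> lies outside \<open>P\<close>, its coefficient in
    \<open>m * e z\<close> minus the \<open>P\<close>-part is exactly \<open>m\<close>, and the
    lower Riesz bound forces quadratic growth against the linear growth from
    \<open>main\<close>.\<close>
  have bound: "(real m)\<^sup>2 \<le> B * (2 + 2 * (real m * K / A))" for m
  proof -
    obtain G g H h where *: "finite G" "G \<subseteq> P" "finite H" "H \<subseteq> D"
      "(L2_norm M (\<lambda>x. of_nat m * e z x - lin_comb e G g x - lin_comb e H h x))\<^sup>2 \<le> 1"
      "(\<Sum>n\<in>H. (cmod (h n))\<^sup>2) \<le> real m * K"
      using main[of 1 m] by auto
    define d where "d n = (if n = z then of_nat m else - g n)" for n
    have zG: "z \<notin> G" using * z by auto
    have "(\<Sum>n\<in>G. d n * e n x) = (\<Sum>n\<in>G. - (g n * e n x))" for x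
      using zG by (intro sum.cong) (auto simp: d_def)
    then have d: "lin_comb e (insert z G) d x = of_nat m * e z x - lin_comb e G g x" for x
      using zG *(1) by (simp add: lin_comb_def d_def sum_negf)
    let ?u = "\<lambda>x. of_nat m * e z x - lin_comb e G g x - lin_comb e H h x"
    \<comment> \<open>\<open>H\<close> collects frequencies from all rounds, so one family
      \<open>Y\<close> must contain all of \<open>D\<close>.\<close>
    have "A * (L2_norm M (lin_comb e H h))\<^sup>2 \<le> (\<Sum>n\<in>H. (cmod (h n))\<^sup>2)"
      using upper *(3,4) unfolding riesz_bounds_def by (meson order_trans)
    then have H: "(L2_norm M (lin_comb e H h))\<^sup>2 \<le> real m * K / A"
      using *(6) AB by (simp add: field_simps)
    obtain X where X: "riesz_bounds M e A B X" "insert z G \<subseteq> X"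
      using lower[of "insert z G"] *(1,2) by blast
    have "(real m)\<^sup>2 = (cmod (d z))\<^sup>2" by (simp add: d_def)
    also have "\<dots> \<le> (\<Sum>n\<in>insert z G. (cmod (d n))\<^sup>2)"
      using *(1) by (intro member_le_sum) auto
    also have "\<dots> \<le> B * (L2_norm M (lin_comb e (insert z G) d))\<^sup>2"
      using X *(1) unfolding riesz_bounds_def by blast
    also have "lin_comb e (insert z G) d = (\<lambda>x. ?u x + lin_comb e H h x)"
      by (auto simp: d)
    also have "(L2_norm M (\<lambda>x. ?u x + lin_comb e H h x))\<^sup>2
        \<le> 2 * (L2_norm M ?u)\<^sup>2 + 2 * (L2_norm M (lin_comb e H h))\<^sup>2"
    proof (intro L2_norm_add_power2_le L2)
      have "(\<lambda>x. lin_comb e (insert z G) d x + (-1) * lin_comb e H h x) \<in> L2_fun M"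
        by (intro L2_fun_add L2_fun_mult L2)
      then show "?u \<in> L2_fun M" by (simp add: d)
    qed
    also have "\<dots> \<le> 2 + 2 * (real m * K / A)" using *(5) H by simp
    finally show ?thesis using AB by simp
  qed
  have "K \<ge> 0" using AB by (simp add: K_def)
  \<comment> \<open>The right side of \<open>bound\<close> is at most
    \<open>m * (2 * B + 2 * B * K / A)\<close> once \<open>m\<close> is at least 1; the summand 1
    ensures this.\<close>
  obtain m :: nat where m: "real m > 2 * B + 2 * B * K / A + 1"
    using reals_Archimedean2 by blast
  have "2 * B * K / A \<ge> 0" using AB \<open>K \<ge> 0\<close> by simp
  then have "real m \<ge> 1" using m AB by linarith
  have "B * (2 + 2 * (real m * K / A)) = 2 * B * 1 + real m * (2 * B * K / A)"
    by (simp add: algebra_simps)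
  also have "\<dots> \<le> 2 * B * real m + real m * (2 * B * K / A)"
    using \<open>real m \<ge> 1\<close> AB by (intro add_right_mono mult_left_mono) auto
  also have "\<dots> = real m * (2 * B + 2 * B * K / A)" by (simp add: algebra_simps)
  also have "\<dots> < real m * real m"
    using m \<open>real m \<ge> 1\<close> by (intro mult_strict_left_mono) auto
  finally show False using bound[of m] by (simp add: power2_eq_square)
qed

section \<open>Exponentials and translation of frequency sets\<close>

lemma exponential_add: "exponential (u + v) x = exponential u x * exponential v x"
  by (simp add: exponential_def inner_add_left distrib_left flip: exp_add)

lemma norm_exponential [simp]: "cmod (exponential \<xi> x) = 1"
proof -
  have "exponential \<xi> x = exp (\<i> * of_real (2 * pi * (\<xi> \<bullet> x)))"
    by (simp add: exponential_def mult_ac)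
  then show ?thesis by (simp only: norm_exp_i_times)
qed

lemma L2_norm_exponential_mult: "L2_norm M (\<lambda>x. exponential v x * f x) = L2_norm M f"
  by (simp add: L2_norm_def norm_mult)

lemma exponential_measurable: "exponential \<xi> \<in> borel_measurable (lebesgue_on S)"
proof -
  have "continuous_on UNIV (exponential \<xi>)"
    unfolding exponential_def by (intro continuous_intros)
  then have "exponential \<xi> \<in> borel_measurable lebesgue"
    by (intro measurable_completion) (simp add: borel_measurable_continuous_onI)
  then show ?thesis by (rule measurable_restrict_space1)
qed

lemma L2_fun_exponential_mult:
  assumes "f \<in> L2_fun (lebesgue_on S)"
  shows "(\<lambda>x. exponential v x * f x) \<in> L2_fun (lebesgue_on S)"
  using assms exponential_measurable[of v S] by (auto simp: L2_fun_def norm_mult)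

lemma lin_comb_exponential_shift:
  "lin_comb exponential ((+) v ` F) c x =
     exponential v x * lin_comb exponential F (\<lambda>n. c (v + n)) x"
  unfolding lin_comb_def
  by (subst sum.reindex) (auto simp: exponential_add sum_distrib_left mult_ac)

text \<open>Multiplication by the unimodular \<open>exponential v\<close> preserves the seminorm and
  moves frequency \<open>n\<close> to \<open>v + n\<close>, hence the same constants.\<close>

lemma riesz_bounds_shift:
  assumes "riesz_bounds (lebesgue_on S) exponential A B N"
  shows "riesz_bounds (lebesgue_on S) exponential A B ((+) v ` N)"
proof -
  let ?M = "lebesgue_on S"
  have norm: "L2_norm ?M (lin_comb exponential ((+) v ` F) c) =
      L2_norm ?M (lin_comb exponential F (\<lambda>n. c (v + n)))" for F c
    unfolding lin_comb_exponential_shift[abs_def] by (rule L2_norm_exponential_mult)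
  have sum: "(\<Sum>n\<in>(+) v ` F. (cmod (c n))\<^sup>2) = (\<Sum>n\<in>F. (cmod (c (v + n)))\<^sup>2)" for F c
    by (subst sum.reindex) auto
  have "A * (L2_norm ?M (lin_comb exponential G c))\<^sup>2 \<le> (\<Sum>n\<in>G. (cmod (c n))\<^sup>2) \<and>
      (\<Sum>n\<in>G. (cmod (c n))\<^sup>2) \<le> B * (L2_norm ?M (lin_comb exponential G c))\<^sup>2"
    if G: "finite G" "G \<subseteq> (+) v ` N" for G c
  proof -
    obtain F where F: "G = (+) v ` F" "F \<subseteq> N" "finite F"
      using G finite_subset_image by metis
    show ?thesis
      unfolding F(1) norm sum
      using conjunct1[OF assms[unfolded riesz_bounds_def], rule_format, OF F(3,2)] .
  qed
  moreover have "\<exists>G c. finite G \<and> G \<subseteq> (+) v ` N \<and>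
       (L2_norm ?M (\<lambda>x. f x - lin_comb exponential G c x))\<^sup>2 \<le> \<epsilon> \<and>
       (\<Sum>n\<in>G. (cmod (c n))\<^sup>2) \<le> B * (L2_norm ?M f)\<^sup>2"
    if f: "f \<in> L2_fun ?M" and "\<epsilon> > 0" for f \<epsilon>
  proof -
    \<comment> \<open>Modulate back by \<open>- v\<close>, approximate with frequencies in
      \<open>N\<close>, then modulate forward.\<close>
    let ?f = "\<lambda>x. exponential (- v) x * f x"
    have "?f \<in> L2_fun ?M" by (rule L2_fun_exponential_mult[OF f])
    then obtain F c where F: "finite F" "F \<subseteq> N"
      "(L2_norm ?M (\<lambda>x. ?f x - lin_comb exponential F c x))\<^sup>2 \<le> \<epsilon>"
      "(\<Sum>n\<in>F. (cmod (c n))\<^sup>2) \<le> B * (L2_norm ?M ?f)\<^sup>2"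
      using conjunct2[OF assms[unfolded riesz_bounds_def], rule_format, OF _ \<open>\<epsilon> > 0\<close>] by blast
    define c' where "c' n = c (n - v)" for n
    have c': "c' (v + n) = c n" for n by (simp add: c'_def)
    have "exponential v x * exponential (- v) x = 1" for x :: 'a
      using exponential_add[of v "- v" x] by (simp add: exponential_def)
    then have "f x - lin_comb exponential ((+) v ` F) c' x =
        exponential v x * (?f x - lin_comb exponential F c x)" for x
      by (simp add: lin_comb_exponential_shift c' right_diff_distrib flip: mult.assoc)
    then have "L2_norm ?M (\<lambda>x. f x - lin_comb exponential ((+) v ` F) c' x) =
        L2_norm ?M (\<lambda>x. ?f x - lin_comb exponential F c x)"
      by (simp add: L2_norm_exponential_mult)
    moreover have "(\<Sum>n\<in>(+) v ` F. (cmod (c' n))\<^sup>2) = (\<Sum>n\<in>F. (cmod (c n))\<^sup>2)"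
      by (simp add: sum c')
    ultimately show ?thesis
      using F L2_norm_exponential_mult[of ?M "- v" f]
      by (intro exI[of _ "(+) v ` F"] exI[of _ c']) auto
  qed
  ultimately show ?thesis unfolding riesz_bounds_def by blast
qed

section \<open>Lattice translations and quasicrystal windows\<close>

lemma
  fixes \<Gamma> :: "'a::euclidean_space set"
  assumes "is_lattice \<Gamma>"
  shows is_lattice_zero: "0 \<in> \<Gamma>"
    and is_lattice_add: "x \<in> \<Gamma> \<Longrightarrow> y \<in> \<Gamma> \<Longrightarrow> x + y \<in> \<Gamma>"
    and is_lattice_uminus: "x \<in> \<Gamma> \<Longrightarrow> - x \<in> \<Gamma>"
proof -
  obtain T :: "'a \<Rightarrow> 'a" where T: "linear T" "\<Gamma> = T ` integer_points"
    using assms unfolding is_lattice_def by blast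
  show "0 \<in> \<Gamma>"
    using T linear_0[OF T(1)] by (auto simp: integer_points_def intro!: image_eqI[of _ _ 0])
  show "x \<in> \<Gamma> \<Longrightarrow> y \<in> \<Gamma> \<Longrightarrow> x + y \<in> \<Gamma>"
    unfolding T(2)
    by (auto simp: integer_points_def inner_add_left simp flip: linear_add[OF T(1)] intro!: imageI)
  show "x \<in> \<Gamma> \<Longrightarrow> - x \<in> \<Gamma>"
    unfolding T(2)
    by (auto simp: integer_points_def simp flip: linear_neg[OF T(1)] intro!: imageI)
qed

lemma quasicrystal_shift:
  assumes "is_lattice \<Gamma>" "\<gamma> \<in> \<Gamma>"
  shows "(+) (fst \<gamma>) ` quasicrystal \<Gamma> I = quasicrystal \<Gamma> ((+) (snd \<gamma>) ` I)"
proof (intro equalityI subsetI)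
  fix x assume "x \<in> (+) (fst \<gamma>) ` quasicrystal \<Gamma> I"
  then obtain \<beta> where "\<beta> \<in> \<Gamma>" "snd \<beta> \<in> I" "x = fst (\<gamma> + \<beta>)"
    by (auto simp: quasicrystal_def)
  then show "x \<in> quasicrystal \<Gamma> ((+) (snd \<gamma>) ` I)"
    using is_lattice_add[OF assms(1) assms(2), of \<beta>] unfolding quasicrystal_def
    by (intro CollectI exI[of _ "\<gamma> + \<beta>"]) auto
next
  fix x assume "x \<in> quasicrystal \<Gamma> ((+) (snd \<gamma>) ` I)"
  then obtain \<beta> where \<beta>: "\<beta> \<in> \<Gamma>" "snd \<beta> \<in> (+) (snd \<gamma>) ` I" "x = fst \<beta>"
    by (auto simp: quasicrystal_def)
  then have "- \<gamma> + \<beta> \<in> \<Gamma>"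
    using assms by (intro is_lattice_add is_lattice_uminus)
  moreover have "snd (- \<gamma> + \<beta>) \<in> I" "x = fst \<gamma> + fst (- \<gamma> + \<beta>)"
    using \<beta> by auto
  ultimately show "x \<in> (+) (fst \<gamma>) ` quasicrystal \<Gamma> I"
    unfolding quasicrystal_def by blast
qed

text \<open>Transfers the exchange contradiction from frequencies to window values:
  \<open>W\<close>, \<open>D\<close> and \<open>Z\<close> live on the second coordinate. The lattice
  point 0 supplies the distinguished frequency, whose exponential is the constant 1.\<close>

lemma quasicrystal_windows_no_exchange:
  fixes \<Gamma> :: "('a::euclidean_space \<times> real) set"
  assumes lattice: "is_lattice \<Gamma>"
    and inj: "inj_on fst \<Gamma>"
    and basis: "riesz_basis_L2 (lebesgue_on S) (quasicrystal \<Gamma> I) exponential"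
    and zero: "0 \<notin> W"
    and lower: "\<And>Z. finite Z \<Longrightarrow> Z \<subseteq> insert 0 W \<inter> snd ` \<Gamma> \<Longrightarrow> \<exists>s\<in>snd ` \<Gamma>. Z \<subseteq> (+) s ` I"
    and upper: "t \<in> snd ` \<Gamma>" "D \<subseteq> (+) t ` I"
    and approx: "\<And>Z. finite Z \<Longrightarrow> Z \<subseteq> D \<inter> snd ` \<Gamma> \<Longrightarrow>
      \<exists>s\<in>snd ` \<Gamma>. (+) s ` I \<inter> snd ` \<Gamma> \<subseteq> W \<union> (D - Z)"
  shows False
proof -
  let ?M = "lebesgue_on S" and ?Q = "quasicrystal \<Gamma>"
  have lift: "\<exists>Z. finite Z \<and> Z \<subseteq> J \<inter> snd ` \<Gamma> \<and> F \<subseteq> ?Q Z"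
    if F: "finite F" "F \<subseteq> ?Q J" for F J
  proof -
    have "F \<subseteq> fst ` {\<gamma>\<in>\<Gamma>. snd \<gamma> \<in> J}"
      using F(2) unfolding quasicrystal_def by blast
    then obtain E where E: "E \<subseteq> {\<gamma>\<in>\<Gamma>. snd \<gamma> \<in> J}" "finite E" "F = fst ` E"
      using F(1) by (meson finite_subset_image)
    then have "finite (snd ` E)" "snd ` E \<subseteq> J \<inter> snd ` \<Gamma>" "F \<subseteq> ?Q (snd ` E)"
      unfolding quasicrystal_def by blast+
    then show ?thesis by blast
  qed
  have mono: "?Q J \<subseteq> ?Q J'" if "J \<inter> snd ` \<Gamma> \<subseteq> J'" for J J'
    using that unfolding quasicrystal_def by blast
  \<comment> \<open>Injectivity of \<open>fst\<close> gives each frequency a single window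
    value.\<close>
  have window_unique: "snd \<gamma> \<in> J" if \<gamma>: "\<gamma> \<in> \<Gamma>" "fst \<gamma> \<in> ?Q J" for \<gamma> J
  proof -
    obtain \<beta> where "\<beta> \<in> \<Gamma>" "fst \<gamma> = fst \<beta>" "snd \<beta> \<in> J"
      using \<gamma>(2) unfolding quasicrystal_def by blast
    then show ?thesis using inj_onD[OF inj] \<gamma>(1) by blast
  qed
  have zero_mem: "0 \<in> \<Gamma>" by (rule is_lattice_zero[OF lattice])
  obtain A B where AB: "A > 0" "B > 0" "riesz_bounds ?M exponential A B (?Q I)"
    using riesz_basis_L2_bounds[OF basis] by blast
  have bounds: "riesz_bounds ?M exponential A B (?Q ((+) s ` I))" if "s \<in> snd ` \<Gamma>" for s
    using that riesz_bounds_shift[OF AB(3)] quasicrystal_shift[OF lattice] by (metis imageE)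
  \<comment> \<open>Applying \<open>lower\<close> to \<open>{0}\<close> shows that the quasicrystal
    is nonempty. One exponential in \<open>L2_fun\<close> then puts them all there, as all have
    modulus 1.\<close>
  have "0 \<in> snd ` \<Gamma>" using zero_mem by (auto intro: image_eqI[of _ _ 0])
  then obtain s where "s \<in> snd ` \<Gamma>" "0 \<in> (+) s ` I"
    using lower[of "{0}"] by auto
  then obtain \<gamma> where "\<gamma> \<in> \<Gamma>" "- snd \<gamma> \<in> I"
    by (auto simp: add_eq_0_iff)
  then have "fst (- \<gamma>) \<in> ?Q I"
    using is_lattice_uminus[OF lattice] unfolding quasicrystal_def by force
  then obtain \<kappa> where "exponential \<kappa> \<in> L2_fun ?M"
    using basis unfolding riesz_basis_L2_def by blast
  then have L2: "exponential \<xi> \<in> L2_fun ?M" for \<xi>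
    using exponential_measurable[of \<xi> S] by (simp add: L2_fun_def)
  show ?thesis
  proof (rule riesz_bounds_no_exchange[where e = exponential and z = 0 and P = "?Q W" and D = "?Q D"])
    show "0 < A" "0 < B" by fact+
    show "exponential n \<in> L2_fun ?M" for n by (rule L2)
    show "0 \<notin> ?Q W"
      using window_unique[OF zero_mem] zero by auto
    show "riesz_bounds ?M exponential A B (?Q ((+) t ` I))" by (rule bounds[OF upper(1)])
    show "?Q D \<subseteq> ?Q ((+) t ` I)" using upper(2) by (intro mono) auto
  next
    fix F assume F: "finite F" "F \<subseteq> insert 0 (?Q W)"
    have "0 \<in> ?Q (insert 0 W)"
      unfolding quasicrystal_def using zero_mem by (intro CollectI exI[of _ 0]) simp
    moreover have "?Q W \<subseteq> ?Q (insert 0 W)" by (intro mono) auto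
    ultimately have "insert 0 (?Q W) \<subseteq> ?Q (insert 0 W)" by blast
    then obtain Z where Z: "finite Z" "Z \<subseteq> insert 0 W \<inter> snd ` \<Gamma>" "F \<subseteq> ?Q Z"
      using lift[OF F(1) order_trans[OF F(2)]] by meson
    obtain s where s: "s \<in> snd ` \<Gamma>" "Z \<subseteq> (+) s ` I"
      using lower[OF Z(1,2)] by blast
    have "?Q Z \<subseteq> ?Q ((+) s ` I)" using s(2) by (intro mono) auto
    then show "\<exists>X. riesz_bounds ?M exponential A B X \<and> F \<subseteq> X"
      using bounds[OF s(1)] Z(3) by blast
  next
    fix F assume F: "finite F" "F \<subseteq> ?Q D"
    obtain Z where Z: "finite Z" "Z \<subseteq> D \<inter> snd ` \<Gamma>" "F \<subseteq> ?Q Z"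
      using lift[OF F] by meson
    obtain s where s: "s \<in> snd ` \<Gamma>" "(+) s ` I \<inter> snd ` \<Gamma> \<subseteq> W \<union> (D - Z)"
      using approx[OF Z(1,2)] by blast
    have "?Q ((+) s ` I) \<subseteq> ?Q W \<union> (?Q D - F)"
    proof
      fix x assume "x \<in> ?Q ((+) s ` I)"
      then obtain \<gamma> where \<gamma>: "\<gamma> \<in> \<Gamma>" "x = fst \<gamma>" "snd \<gamma> \<in> W \<union> (D - Z)"
        using s(2) unfolding quasicrystal_def by blast
      moreover have "x \<notin> F" if "snd \<gamma> \<notin> Z"
        using that window_unique[OF \<gamma>(1), of Z] Z(3) \<gamma>(2) by blast
      ultimately show "x \<in> ?Q W \<union> (?Q D - F)"
        unfolding quasicrystal_def by blast
    qed
    then show "\<exists>X. riesz_bounds ?M exponential A B X \<and> X \<subseteq> ?Q W \<union> (?Q D - F)"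
      using bounds[OF s(1)] by blast
  qed
qed

section \<open>Placing the windows for the two kinds of half-open interval\<close>

theorem theorem1p1:
  fixes \<Gamma> :: "((real ^ 'd) \<times> real) set" and a b :: real and I :: "real set"
  assumes "is_lattice \<Gamma>"
    and "general_position \<Gamma>"
    and "a < b"
    and "I = {a..<b} \<or> I = {a<..b}"
    and "b - a \<notin> snd ` \<Gamma>"
  shows "\<not> (\<exists>S :: (real ^ 'd) set. riemann_measurable S \<and>
    riesz_basis_L2 (lebesgue_on S) (quasicrystal \<Gamma> I) exponential)"
proof
  assume "\<exists>S :: (real ^ 'd) set. riemann_measurable S \<and>
    riesz_basis_L2 (lebesgue_on S) (quasicrystal \<Gamma> I) exponential"
  then obtain S :: "(real ^ 'd) set"
    where basis: "riesz_basis_L2 (lebesgue_on S) (quasicrystal \<Gamma> I) exponential" by blast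
  have inj: "inj_on fst \<Gamma>" and closure_snd: "closure (snd ` \<Gamma>) = UNIV"
    using assms(2) by (auto simp: general_position_def)
  \<comment> \<open>By density, a lattice shift moves the endpoint \<open>r\<close> into any
    prescribed open interval.\<close>
  have pick: "\<exists>s\<in>snd ` \<Gamma>. u < r + s \<and> r + s < v" if "u < v" for r u v :: real
  proof -
    have "{u - r<..<v - r} \<inter> closure (snd ` \<Gamma>) \<noteq> {}" using that by (simp add: closure_snd)
    then have "{u - r<..<v - r} \<inter> snd ` \<Gamma> \<noteq> {}"
      using open_Int_closure_eq_empty[of "{u - r<..<v - r}" "snd ` \<Gamma>"] by simp
    then obtain s where "s \<in> snd ` \<Gamma>" "u - r < s" "s < v - r"
      by (metis disjoint_iff greaterThanLessThan_iff)
    then show ?thesis by (intro bexI[of _ s]) auto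
  qed
  define L where "L = b - a"
  have L: "L > 0" "L \<notin> snd ` \<Gamma>" using assms(3,5) by (auto simp: L_def)
  have L': "- L \<notin> snd ` \<Gamma>"
  proof
    assume "- L \<in> snd ` \<Gamma>"
    then obtain \<gamma> where "\<gamma> \<in> \<Gamma>" "- L = snd \<gamma>" by blast
    then have "- \<gamma> \<in> \<Gamma>" "L = snd (- \<gamma>)"
      using is_lattice_uminus[OF assms(1)] by auto
    with L(2) show False by blast
  qed
  show False using assms(4)
  proof
    assume I: "I = {a..<b}"
    have shift: "(+) s ` I = {a + s..<L + (a + s)}" for s
      by (simp add: I L_def add.commute)
    \<comment> \<open>\<open>D\<close> has half the window length, so a window starting between
      \<open>L / 2\<close> and \<open>L\<close> covers it.\<close>
    obtain t where t: "t \<in> snd ` \<Gamma>" "L / 2 < a + t" "a + t < L"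
      using pick[of "L / 2" L a] L(1) by auto
    show False
    proof (rule quasicrystal_windows_no_exchange[OF assms(1) inj basis,
          where W = "{0<..<L}" and D = "{L..<L + L / 2}" and t = t])
      show "0 \<notin> {0<..<L}" by simp
      show "t \<in> snd ` \<Gamma>" by fact
      show "{L..<L + L / 2} \<subseteq> (+) t ` I" using t by (auto simp: shift)
    next
      fix Z assume Z: "finite Z" "Z \<subseteq> insert 0 {0<..<L} \<inter> snd ` \<Gamma>"
      \<comment> \<open>A finite \<open>Z\<close> leaves a gap below \<open>L\<close>; a left shift
        by less than this gap keeps \<open>Z\<close> inside. Inserting 0 handles empty
        \<open>Z\<close>.\<close>
      have "Max (insert 0 Z) < L" using Z L by auto
      then obtain s where s: "s \<in> snd ` \<Gamma>" "Max (insert 0 Z) - L < a + s" "a + s < 0"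
        using pick[of "Max (insert 0 Z) - L" 0 a] by (metis diff_less_0_iff_less)
      have "z \<in> (+) s ` I" if "z \<in> Z" for z
      proof -
        have "z \<le> Max (insert 0 Z)" using that Z(1) by simp
        moreover have "z \<ge> 0" using that Z(2) by auto
        ultimately show ?thesis using s by (simp add: shift)
      qed
      then show "\<exists>s\<in>snd ` \<Gamma>. Z \<subseteq> (+) s ` I" using s(1) by blast
    next
      fix Z assume Z: "finite Z" "Z \<subseteq> {L..<L + L / 2} \<inter> snd ` \<Gamma>"
      define \<mu> where "\<mu> = Min (insert (L + L / 2) Z)"
      have "\<forall>z\<in>Z. z > L" using Z(2) L(2) by (force simp: less_le)
      then have "\<mu> > L" using Z(1) L(1) by (simp add: \<mu>_def)
      then obtain s where s: "s \<in> snd ` \<Gamma>" "0 < a + s" "a + s < \<mu> - L"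
        using pick[of 0 "\<mu> - L" a] by (metis diff_gt_0_iff_gt)
      have \<mu>: "\<mu> \<le> z" if "z \<in> insert (L + L / 2) Z" for z
        unfolding \<mu>_def using Z(1) that by (intro Min_le) auto
      have "(+) s ` I \<subseteq> {0<..<L} \<union> ({L..<L + L / 2} - Z)"
      proof
        fix x assume "x \<in> (+) s ` I"
        then have x: "0 < x" "x < \<mu>" using s by (auto simp: shift)
        moreover have "x < L + L / 2" "x \<notin> Z"
          using x(2) \<mu>[of "L + L / 2"] \<mu>[of x] by auto
        ultimately show "x \<in> {0<..<L} \<union> ({L..<L + L / 2} - Z)" by auto
      qed
      then show "\<exists>s\<in>snd ` \<Gamma>. (+) s ` I \<inter> snd ` \<Gamma> \<subseteq> {0<..<L} \<union> ({L..<L + L / 2} - Z)"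
        using s(1) by blast
    qed
  next
    \<comment> \<open>The reflected case: 0 is the closed right end, small shifts reverse direction,
      and the far end \<open>- L\<close> is excluded by \<open>L'\<close>.\<close>
    assume I: "I = {a<..b}"
    have shift: "(+) s ` I = {b + s - L<..b + s}" for s
      unfolding I L_def image_add_greaterThanAtMost by (simp add: algebra_simps)
    obtain t where t: "t \<in> snd ` \<Gamma>" "- L < b + t" "b + t < - (L / 2)"
      using pick[of "- L" "- (L / 2)" b] L(1) by auto
    show False
    proof (rule quasicrystal_windows_no_exchange[OF assms(1) inj basis,
          where W = "{-L<..<0}" and D = "{- L - L / 2<..- L}" and t = t])
      show "0 \<notin> {-L<..<0}" by simp
      show "t \<in> snd ` \<Gamma>" by fact
      show "{- L - L / 2<..- L} \<subseteq> (+) t ` I" using t by (auto simp: shift)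
    next
      fix Z assume Z: "finite Z" "Z \<subseteq> insert 0 {-L<..<0} \<inter> snd ` \<Gamma>"
      have "Min (insert 0 Z) > - L" using Z L by auto
      then obtain s where s: "s \<in> snd ` \<Gamma>" "0 < b + s" "b + s < Min (insert 0 Z) - - L"
        using pick[of 0 "Min (insert 0 Z) - - L" b] by (metis diff_gt_0_iff_gt)
      have "z \<in> (+) s ` I" if "z \<in> Z" for z
      proof -
        have "z \<ge> Min (insert 0 Z)" using that Z(1) by simp
        moreover have "z \<le> 0" using that Z(2) by auto
        ultimately show ?thesis using s by (simp add: shift)
      qed
      then show "\<exists>s\<in>snd ` \<Gamma>. Z \<subseteq> (+) s ` I" using s(1) by blast
    next
      fix Z assume Z: "finite Z" "Z \<subseteq> {- L - L / 2<..- L} \<inter> snd ` \<Gamma>"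
      \<comment> \<open>The inserted left end of \<open>D\<close> covers empty \<open>Z\<close> and
        keeps the shifted window from running past \<open>D\<close>.\<close>
      define \<mu> where "\<mu> = Max (insert (- L - L / 2) Z)"
      have "\<forall>z\<in>Z. z < - L" using Z(2) L' by (force simp: less_le)
      then have "\<mu> < - L" using Z(1) L(1) by (simp add: \<mu>_def)
      then obtain s where s: "s \<in> snd ` \<Gamma>" "\<mu> + L < b + s" "b + s < 0"
        using pick[of "\<mu> + L" 0 b] by auto
      have \<mu>: "z \<le> \<mu>" if "z \<in> insert (- L - L / 2) Z" for z
        unfolding \<mu>_def using Z(1) that by (intro Max_ge) auto
      have "(+) s ` I \<subseteq> {-L<..<0} \<union> ({- L - L / 2<..- L} - Z)"
      proof
        fix x assume "x \<in> (+) s ` I"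
        then have x: "\<mu> < x" "x < 0" using s by (auto simp: shift)
        moreover have "- L - L / 2 < x" "x \<notin> Z"
          using x(1) \<mu>[of "- L - L / 2"] \<mu>[of x] by auto
        ultimately show "x \<in> {-L<..<0} \<union> ({- L - L / 2<..- L} - Z)" by auto
      qed
      then show "\<exists>s\<in>snd ` \<Gamma>. (+) s ` I \<inter> snd ` \<Gamma> \<subseteq> {-L<..<0} \<union> ({- L - L / 2<..- L} - Z)"
        using s(1) by blast
    qed
  qed
qed

end
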